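(* The planar discrepancy density $\rho_{\mathbb{C}}$ and the tight planar discrepancy density $\rho_{\mathbb{C}}^*$ coincide: $$\rho_{\mathbb{C}}=\rho_{\mathbb{C}}^*.$$
   Context: Notation: $\mathbb{D}(0,R)=\{z\in\mathbb{C}:|z|<R\}$ and $dA(z)=\frac{dx\,dy}{\pi}$ for $z=x+iy$. $\operatorname{Pol}(\mathbb{C})$ is the set of all complex polynomials in one variable. For $R>0$ and an entire function $f$ put $$\Psi_f(z,R)=\left(|f(z)|e^{-|z|^2}-1_{\mathbb{D}(0,R)}(z)\right)^2,\qquad z\in\mathbb{C},$$ and define $$\rho_{\mathbb{C}}=\liminf_{R\to\infty}\inf_{f\in\operatorname{Pol}(\mathbb{C})}\frac{1}{R^2}\int_{\mathbb{D}(0,R)}\Psi_f(z,R)\,dA(z),\qquad \rho_{\mathbb{C}}^*=\liminf_{R\to\infty}\inf_{f\in\operatorname{Pol}(\mathbb{C})}\frac{1}{R^2}\int_{\mathbb{C}}\Psi_f(z,R)\,dA(z).$$ *)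

theory Defs
  imports "HOL-Analysis.Analysis" "HOL-Computational_Algebra.Polynomial"
begin

text \<open>On \<open>complex\<close>, \<open>lborel\<close> is \<open>dx dy\<close>, so this is \<open>dA(z) = dx dy / pi\<close> and the unit disc has measure 1.\<close>

definition area :: "complex measure" where
  "area = scale_measure (ennreal (1 / pi)) lborel"

definition Pol :: "(complex \<Rightarrow> complex) set" where
  "Pol = range poly"

definition Psi :: "(complex \<Rightarrow> complex) \<Rightarrow> complex \<Rightarrow> real \<Rightarrow> real" where
  "Psi f z R = (cmod (f z) * exp (- (cmod z)\<^sup>2) - indicator (ball 0 R) z)\<^sup>2"

text \<open>
  As \<open>Psi\<close> is nonnegative, the integrals, the infima and the lower limits are all taken in
  the complete lattice \<open>ennreal\<close>; no integrability or boundedness conventions are involved.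
\<close>

definition planar_discrepancy_density :: ennreal where
  "planar_discrepancy_density =
     Liminf at_top (\<lambda>R::real. INF f\<in>Pol.
       ennreal (1 / R\<^sup>2) * (\<integral>\<^sup>+ z\<in>ball 0 R. ennreal (Psi f z R) \<partial>area))"

definition tight_planar_discrepancy_density :: ennreal where
  "tight_planar_discrepancy_density =
     Liminf at_top (\<lambda>R::real. INF f\<in>Pol.
       ennreal (1 / R\<^sup>2) * (\<integral>\<^sup>+ z. ennreal (Psi f z R) \<partial>area))"

end

theory Submission imports Defs "HOL-Library.Real_Mod" begin

text \<open>
  Given a polynomial \<open>f = \<Sum> a\<^sub>n z\<^sup>n\<close> that is good on the disc of radius \<open>R\<close>, multiply it by a
  Lipschitz cutoff \<open>\<chi>\<close> of \<open>s = |z|\<^sup>2\<close> that drops from 1 to 0 on a thin annulus inside the disc. By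
  convexity this costs at most the area of the annulus. In place of a weighted
  \<open>L\<^sup>2\<close>-estimate for the Cauchy-Riemann operator, \<open>\<chi> f\<close> is corrected to the polynomial
  \<open>g = \<Sum> m\<^sub>n a\<^sub>n z\<^sup>n\<close>, where \<open>m\<^sub>n\<close> is the value of \<open>\<chi>\<close> at the mean of the gamma density
  proportional to \<open>s\<^sup>n e\<^sup>-\<^sup>2\<^sup>s\<close> (or 0 if that mean lies beyond the support of \<open>\<chi>\<close>). Monomials are
  orthogonal for every radial weight, so the error \<open>\<chi> f - g\<close> is controlled by the variances of
  these densities and is negligible against \<open>R\<^sup>2\<close>.
\<close>

subsection \<open>Gamma densities and the cutoff\<close>

text \<open>With w(s) = s^n e^(-2s), the derivative of s w(s) is w(s) times a linear factor
  vanishing at c = (n+1)/2, the mean of the gamma density proportional to w. This drives the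
  integrations by parts in the next two lemmas.\<close>

lemma has_real_derivative_gamma_density:
  "((\<lambda>s. s * (s ^ n * exp (- 2 * s))) has_real_derivative
    2 * ((real n + 1) / 2 - s) * (s ^ n * exp (- 2 * s))) (at s within A)"
proof -
  have "((\<lambda>s::real. s ^ Suc n) has_real_derivative real (Suc n) * s ^ n) (at s within A)"
    by (rule DERIV_cong[OF DERIV_pow]) simp
  moreover have "((\<lambda>s::real. exp (- 2 * s)) has_real_derivative - 2 * exp (- 2 * s)) (at s within A)"
    by (auto intro!: derivative_eq_intros)
  ultimately have "((\<lambda>s. s ^ Suc n * exp (- 2 * s)) has_real_derivative
      2 * ((real n + 1) / 2 - s) * (s ^ n * exp (- 2 * s))) (at s within A)"
    by (rule DERIV_cong[OF DERIV_mult]) (simp add: field_simps)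
  then show ?thesis
    by (simp only: power_Suc mult.assoc)
qed

text \<open>On the whole half line this is an equality: c is the mean and c/2 the variance of the
  gamma density. Truncating at \<open>B\<close> leaves only a boundary term, which is nonpositive
  once \<open>B\<close> is at least the mean.\<close>

lemma gamma_variance_bound:
  fixes n :: nat and B :: real
  defines "c \<equiv> (real n + 1) / 2"
  assumes "c \<le> B"
  shows "integral {0..B} (\<lambda>s. (s - c)\<^sup>2 * (s ^ n * exp (- 2 * s)))
    \<le> c / 2 * integral {0..B} (\<lambda>s. s ^ n * exp (- 2 * s))"
proof -
  let ?w = "\<lambda>s::real. s ^ n * exp (- 2 * s)"
  \<comment> \<open>The factor (c - s)/2 produces (s - c)^2 w together with a term linear in s; the
    shift by 1/4 turns that term into the constant multiple -(c/2) w.\<close>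
  let ?H = "\<lambda>s::real. ((c - s) / 2 - 1 / 4) * (s * (s ^ n * exp (- 2 * s)))"
  have c: "c > 0" by (simp add: c_def)
  have alg: "- 1 / 2 * (s * w) + 2 * ((real n + 1) / 2 - s) * w * ((c - s) / 2 - 1 / 4)
      = (s - c)\<^sup>2 * w - c / 2 * w" for s w :: real
    by (simp add: c_def power2_eq_square field_simps)
  have H: "((\<lambda>s. (s - c)\<^sup>2 * ?w s - c / 2 * ?w s) has_integral (?H B - ?H 0)) {0..B}"
  proof (rule fundamental_theorem_of_calculus)
    fix s :: real
    have "(?H has_real_derivative ((s - c)\<^sup>2 * ?w s - c / 2 * ?w s)) (at s within {0..B})"
    proof (rule DERIV_cong[OF DERIV_mult[OF _ has_real_derivative_gamma_density]])
      show "((\<lambda>s. (c - s) / 2 - 1 / 4) has_real_derivative - 1 / 2) (at s within {0..B})"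
        by (auto intro!: derivative_eq_intros)
    qed (use alg[of s "?w s"] in simp)
    then show "(?H has_vector_derivative ((s - c)\<^sup>2 * ?w s - c / 2 * ?w s)) (at s within {0..B})"
      by (simp add: has_real_derivative_iff_has_vector_derivative)
  qed (use assms(2) c in auto)
  have "integral {0..B} (\<lambda>s. (s - c)\<^sup>2 * ?w s) - c / 2 * integral {0..B} ?w
      = integral {0..B} (\<lambda>s. (s - c)\<^sup>2 * ?w s - c / 2 * ?w s)"
    by (subst integral_diff) (auto intro!: integrable_continuous_real continuous_intros)
  also have "\<dots> = ?H B" using H by (simp add: integral_unique)
  also have "\<dots> \<le> 0"
  proof -
    have "0 \<le> B * (B ^ n * exp (- 2 * B))"
      using assms(2) c by (auto intro!: mult_nonneg_nonneg)
    then show ?thesis using assms(2) by (intro mult_nonpos_nonneg) auto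
  qed
  finally show ?thesis by simp
qed

text \<open>Counterpart of the variance bound when the mean c lies at or beyond the endpoint. There
  (B - s)^2 is at most (B - s)(c - s), and integration by parts turns the latter into s/2 with no
  boundary terms, since the antiderivative vanishes at both 0 and \<open>B\<close>; finally s is at
  most \<open>B\<close>.\<close>

lemma gamma_endpoint_bound:
  fixes n :: nat and B :: real
  assumes "0 \<le> B" "B \<le> (real n + 1) / 2"
  shows "integral {0..B} (\<lambda>s. (B - s)\<^sup>2 * (s ^ n * exp (- 2 * s)))
    \<le> B / 2 * integral {0..B} (\<lambda>s. s ^ n * exp (- 2 * s))"
proof -
  define c where "c = (real n + 1) / 2"
  let ?w = "\<lambda>s::real. s ^ n * exp (- 2 * s)"
  let ?H = "\<lambda>s::real. (B - s) / 2 * (s * (s ^ n * exp (- 2 * s)))"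
  have alg: "- 1 / 2 * (s * w) + 2 * ((real n + 1) / 2 - s) * w * ((B - s) / 2)
      = (B - s) * (c - s) * w - s / 2 * w" for s w :: real
    by (simp add: c_def field_simps)
  have H: "((\<lambda>s. (B - s) * (c - s) * ?w s - s / 2 * ?w s) has_integral (?H B - ?H 0)) {0..B}"
  proof (rule fundamental_theorem_of_calculus)
    fix s :: real
    have "(?H has_real_derivative ((B - s) * (c - s) * ?w s - s / 2 * ?w s)) (at s within {0..B})"
    proof (rule DERIV_cong[OF DERIV_mult[OF _ has_real_derivative_gamma_density]])
      show "((\<lambda>s. (B - s) / 2) has_real_derivative - 1 / 2) (at s within {0..B})"
        by (auto intro!: derivative_eq_intros)
    qed (use alg[of s "?w s"] in simp)
    then show "(?H has_vector_derivative ((B - s) * (c - s) * ?w s - s / 2 * ?w s)) (at s within {0..B})"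
      by (simp add: has_real_derivative_iff_has_vector_derivative)
  qed (use assms in auto)
  have "integral {0..B} (\<lambda>s. (B - s)\<^sup>2 * ?w s) - B / 2 * integral {0..B} ?w
      = integral {0..B} (\<lambda>s. (B - s)\<^sup>2 * ?w s - B / 2 * ?w s)"
    by (subst integral_diff) (auto intro!: integrable_continuous_real continuous_intros)
  also have "\<dots> \<le> integral {0..B} (\<lambda>s. (B - s) * (c - s) * ?w s - s / 2 * ?w s)"
  proof (rule integral_le)
    fix s assume s: "s \<in> {0..B}"
    have "(B - s)\<^sup>2 \<le> (B - s) * (c - s)"
      using s assms by (auto simp: power2_eq_square c_def intro!: mult_left_mono)
    then have "(B - s)\<^sup>2 - B / 2 \<le> (B - s) * (c - s) - s / 2" using s by auto
    then have "((B - s)\<^sup>2 - B / 2) * ?w s \<le> ((B - s) * (c - s) - s / 2) * ?w s"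
      using s by (intro mult_right_mono) auto
    then show "(B - s)\<^sup>2 * ?w s - B / 2 * ?w s \<le> (B - s) * (c - s) * ?w s - s / 2 * ?w s"
      by (simp add: left_diff_distrib)
  qed (auto intro!: integrable_continuous_real continuous_intros)
  also have "\<dots> = 0" using H by (simp add: integral_unique)
  finally show ?thesis by simp
qed

section \<open>The radial cutoff and its multipliers\<close>

text \<open>Used with s = |z|^2 and T = R^2. It is 1 up to (1 - 2d)T, falls linearly with slope
  1/(dT), and is 0 from (1 - d)T on. The remaining gap of length dT before T is what makes the tail
  estimate in \<open>cutoff_multiplier\<close> work.\<close>

definition cutoff :: "real \<Rightarrow> real \<Rightarrow> real \<Rightarrow> real" where
  "cutoff d T s = min 1 (max 0 (((1 - d) * T - s) / (d * T)))"

lemma cutoff_nonneg: "0 \<le> cutoff d T s"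
  and cutoff_le_1: "cutoff d T s \<le> 1"
  by (auto simp: cutoff_def)

lemma cutoff_eq_0: "0 < d \<Longrightarrow> 0 < T \<Longrightarrow> (1 - d) * T \<le> s \<Longrightarrow> cutoff d T s = 0"

proof -
  assume "0 < d" "0 < T" "(1 - d) * T \<le> s"
  then have "((1 - d) * T - s) / (d * T) \<le> 0" by (intro divide_nonpos_pos) auto
  then show ?thesis by (simp add: cutoff_def)
qed

lemma cutoff_eq_1: "0 < d \<Longrightarrow> 0 < T \<Longrightarrow> s \<le> (1 - 2 * d) * T \<Longrightarrow> cutoff d T s = 1"

proof -
  assume "0 < d" "0 < T" "s \<le> (1 - 2 * d) * T"
  then have "1 \<le> ((1 - d) * T - s) / (d * T)"
    by (subst le_divide_eq_1_pos) (auto simp: algebra_simps)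
  then show ?thesis by (simp add: cutoff_def)
qed

lemma continuous_on_cutoff [continuous_intros]:
  "continuous_on A g \<Longrightarrow> continuous_on A (\<lambda>x. cutoff d T (g x))"
  unfolding cutoff_def divide_inverse by (intro continuous_intros)

lemma borel_measurable_cutoff [measurable]: "cutoff d T \<in> borel_measurable borel"
  unfolding cutoff_def by measurable

lemma cutoff_lipschitz:
  assumes "0 < d" "0 < T"
  shows "\<bar>cutoff d T s - cutoff d T t\<bar> \<le> \<bar>s - t\<bar> / (d * T)"
proof -
  have "\<bar>cutoff d T s - cutoff d T t\<bar> \<le> \<bar>((1 - d) * T - s) / (d * T) - ((1 - d) * T - t) / (d * T)\<bar>"
    unfolding cutoff_def by (auto simp: min_def max_def abs_if)
  also have "\<dots> = \<bar>s - t\<bar> / (d * T)"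
    using assms by (simp add: diff_divide_distrib[symmetric] abs_minus_commute)
  finally show ?thesis .
qed

lemma cutoff_lipschitz_sq:
  assumes "0 < d" "0 < T"
  shows "(cutoff d T s - cutoff d T t)\<^sup>2 \<le> (1 / (d * T))\<^sup>2 * (s - t)\<^sup>2"
  using power_mono[OF cutoff_lipschitz[OF assms, of s t] abs_ge_zero, of 2]
  by (simp add: power_divide power_mult_distrib)

text \<open>The cutoff is Lipschitz with constant 1/(dT), so replacing it by its value at the mean c
  costs at most the variance, of order T, times 1/(dT)^2. The essential point is that the error over
  any \<open>{0..B}\<close> is charged to the mass on \<open>{0..T}\<close> alone. The two cases
  distinguish whether the mean lies in the support of the cutoff.\<close>

lemma cutoff_multiplier:
  fixes n :: nat and d T :: real
  assumes d: "0 < d" "d < 1" and T: "1 / d\<^sup>2 \<le> T"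
  obtains m :: real where
    "\<And>B. 0 \<le> B \<Longrightarrow> integral {0..B} (\<lambda>s. (m - cutoff d T s)\<^sup>2 * (s ^ n * exp (- 2 * s)))
      \<le> 1 / (d\<^sup>2 * T) * integral {0..T} (\<lambda>s. s ^ n * exp (- 2 * s))"
proof -
  let ?w = "\<lambda>s::real. s ^ n * exp (- 2 * s)"
  define c where "c = (real n + 1) / 2"
  define L where "L = 1 / (d * T)"
  have "0 < 1 / d\<^sup>2" using d by simp
  with T have T0: "0 < T" by linarith
  have LT: "L\<^sup>2 * T = 1 / (d\<^sup>2 * T)"
    using T0 by (simp add: L_def power_divide power_mult_distrib power2_eq_square)
  have mono: "integral {0..A} h \<le> integral {0..B} h"
    if "A \<le> B" "\<And>s. s \<in> {0..B} \<Longrightarrow> 0 \<le> h s" "continuous_on {0..B} h" for A B and h :: "real \<Rightarrow> real"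
    using that by (intro integral_subset_le integrable_continuous_real)
      (auto intro: continuous_on_subset)
  show thesis
  proof (cases "c \<le> (1 - d) * T")
    case True
    have dT: "d * T \<le> T - c" using True by (simp add: algebra_simps)
    have cT: "c < T" using dT d T0 by (smt (verit) mult_pos_pos)
    have main: "integral {0..B} (\<lambda>s. (cutoff d T c - cutoff d T s)\<^sup>2 * ?w s)
        \<le> 1 / (d\<^sup>2 * T) * integral {0..T} ?w" if B: "T \<le> B" for B
    proof -
      have var: "integral {0..B} (\<lambda>s. (s - c)\<^sup>2 * ?w s) \<le> c / 2 * integral {0..B} ?w"
        using gamma_variance_bound[of n B] B cT by (simp add: c_def)
      have split: "integral {0..B} ?w = integral {0..T} ?w + integral {T..B} ?w"
        by (rule Henstock_Kurzweil_Integration.integral_combine[symmetric])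
          (use T0 B in \<open>auto intro!: integrable_continuous_real continuous_intros\<close>)
      \<comment> \<open>Chebyshev's inequality: points beyond \<open>T\<close> are at distance at
        least \<open>d * T\<close> from the mean, so the variance bounds the mass there.\<close>
      have "(d * T)\<^sup>2 * integral {T..B} ?w = integral {T..B} (\<lambda>s. (d * T)\<^sup>2 * ?w s)"
        by simp
      also have "\<dots> \<le> integral {T..B} (\<lambda>s. (s - c)\<^sup>2 * ?w s)"
      proof (rule integral_le)
        fix s assume "s \<in> {T..B}"
        then show "(d * T)\<^sup>2 * ?w s \<le> (s - c)\<^sup>2 * ?w s"
          using dT d T0 by (intro mult_right_mono power_mono) auto
      qed (auto intro!: integrable_continuous_real continuous_intros)
      also have "\<dots> \<le> integral {0..B} (\<lambda>s. (s - c)\<^sup>2 * ?w s)"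
        using T0 by (intro integral_subset_le integrable_continuous_real) (auto intro!: continuous_intros)
      finally have "(d * T)\<^sup>2 * integral {T..B} ?w \<le> c / 2 * integral {0..B} ?w"
        using var by linarith
      \<comment> \<open>The hypothesis 1/d^2 \<le> T makes the variance at most half of (dT)^2, so
        at most half of the mass lies beyond \<open>T\<close>.\<close>
      moreover have "c / 2 \<le> (d * T)\<^sup>2 / 2"
      proof -
        have "1 \<le> d\<^sup>2 * T" using T d by (simp add: field_simps)
        then have "T * 1 \<le> T * (d\<^sup>2 * T)" using T0 by (intro mult_left_mono) auto
        then show ?thesis using cT by (simp add: power2_eq_square algebra_simps)
      qed
      moreover have w0: "0 \<le> integral {0..B} ?w" by (intro integral_nonneg integrable_continuous_real continuous_intros) auto
      ultimately have "(d * T)\<^sup>2 * integral {T..B} ?w \<le> (d * T)\<^sup>2 / 2 * integral {0..B} ?w"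
        by (meson mult_right_mono order_trans)
      then have "(d * T)\<^sup>2 * integral {T..B} ?w \<le> (d * T)\<^sup>2 * (integral {0..B} ?w / 2)" by simp
      then have "integral {T..B} ?w \<le> integral {0..B} ?w / 2"
        by (rule mult_left_le_imp_le) (use d T0 in auto)
      then have half: "integral {0..B} ?w \<le> 2 * integral {0..T} ?w" using split by linarith
      have "integral {0..B} (\<lambda>s. (cutoff d T c - cutoff d T s)\<^sup>2 * ?w s)
          \<le> integral {0..B} (\<lambda>s. L\<^sup>2 * ((s - c)\<^sup>2 * ?w s))"
      proof (rule integral_le)
        fix s assume s: "s \<in> {0..B}"
        have "(cutoff d T c - cutoff d T s)\<^sup>2 * ?w s \<le> (L\<^sup>2 * (s - c)\<^sup>2) * ?w s"
          using cutoff_lipschitz_sq[OF d(1) T0, of c s] s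
          by (intro mult_right_mono) (auto simp: L_def power2_commute)
        then show "(cutoff d T c - cutoff d T s)\<^sup>2 * ?w s \<le> L\<^sup>2 * ((s - c)\<^sup>2 * ?w s)"
          by (simp only: mult.assoc)
      qed (intro integrable_continuous_real continuous_intros)+
      also have "\<dots> \<le> L\<^sup>2 * (c / 2 * integral {0..B} ?w)"
        unfolding integral_mult_right by (intro mult_left_mono var) auto
      \<comment> \<open>The factor 2 lost in passing from \<open>{0..B}\<close> to
        \<open>{0..T}\<close> cancels the 1/2 in the variance bound.\<close>
      also have "\<dots> \<le> L\<^sup>2 * (T / 2 * (2 * integral {0..T} ?w))"
        using cT half T0 w0 by (intro mult_left_mono mult_mono) auto
      also have "\<dots> = 1 / (d\<^sup>2 * T) * integral {0..T} ?w" using LT by (simp add: mult.assoc[symmetric])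
      finally show ?thesis .
    qed
    show thesis
    proof (rule that[of "cutoff d T c"])
      fix B :: real assume "0 \<le> B"
      have "integral {0..B} (\<lambda>s. (cutoff d T c - cutoff d T s)\<^sup>2 * ?w s)
         \<le> integral {0..max T B} (\<lambda>s. (cutoff d T c - cutoff d T s)\<^sup>2 * ?w s)"
        by (rule mono) (auto intro!: continuous_intros)
      also note main[of "max T B"]
      finally show "integral {0..B} (\<lambda>s. (cutoff d T c - cutoff d T s)\<^sup>2 * ?w s)
        \<le> 1 / (d\<^sup>2 * T) * integral {0..T} ?w" by simp
    qed
  next
    case False
    define A where "A = (1 - d) * T"
    have A: "0 < A" "A \<le> c" "A < T" using False d T0 by (auto simp: A_def algebra_simps)
    have wA: "integral {0..A} ?w \<le> integral {0..T} ?w" "0 \<le> integral {0..A} ?w"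
      using A by (auto intro!: mono integral_nonneg integrable_continuous_real continuous_intros)
    show thesis
    \<comment> \<open>The cutoff vanishes from \<open>A\<close> on. On \<open>{0..A}\<close>,
      reading 0 as the value of the cutoff at \<open>A\<close> bounds the error by the squared
      distance to \<open>A\<close>, and \<open>gamma_endpoint_bound\<close> applies because the mean
      is at least \<open>A\<close>.\<close>
    proof (rule that[of 0])
      fix B :: real assume B: "0 \<le> B"
      have "integral {0..B} (\<lambda>s. (0 - cutoff d T s)\<^sup>2 * ?w s)
         \<le> integral {0..max A B} (\<lambda>s. (0 - cutoff d T s)\<^sup>2 * ?w s)"
        by (rule mono) (auto intro!: continuous_intros)
      also have "\<dots> = integral {0..A} (\<lambda>s. (0 - cutoff d T s)\<^sup>2 * ?w s)
          + integral {A..max A B} (\<lambda>s. (0 - cutoff d T s)\<^sup>2 * ?w s)"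
        by (rule Henstock_Kurzweil_Integration.integral_combine[symmetric])
          (use A in \<open>auto intro!: integrable_continuous_real continuous_intros\<close>)
      also have "integral {A..max A B} (\<lambda>s. (0 - cutoff d T s)\<^sup>2 * ?w s) = integral {A..max A B} (\<lambda>s. 0)"
        by (rule integral_cong) (use cutoff_eq_0[OF d(1) T0] in \<open>auto simp: A_def\<close>)
      also have "integral {0..A} (\<lambda>s. (0 - cutoff d T s)\<^sup>2 * ?w s)
          \<le> integral {0..A} (\<lambda>s. L\<^sup>2 * ((A - s)\<^sup>2 * ?w s))"
      proof (rule integral_le)
        fix s assume s: "s \<in> {0..A}"
        have "(0 - cutoff d T s)\<^sup>2 * ?w s \<le> (L\<^sup>2 * (A - s)\<^sup>2) * ?w s"
          using cutoff_lipschitz_sq[OF d(1) T0, of A s] cutoff_eq_0[OF d(1) T0, of A] s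
          by (intro mult_right_mono) (auto simp: L_def A_def)
        then show "(0 - cutoff d T s)\<^sup>2 * ?w s \<le> L\<^sup>2 * ((A - s)\<^sup>2 * ?w s)"
          by (simp only: mult.assoc)
      qed (intro integrable_continuous_real continuous_intros)+
      also have "\<dots> \<le> L\<^sup>2 * (A / 2 * integral {0..A} ?w)"
        unfolding integral_mult_right
        using A by (intro mult_left_mono gamma_endpoint_bound) (auto simp: c_def)
      also have "\<dots> \<le> L\<^sup>2 * (T * integral {0..T} ?w)"
        using wA A by (intro mult_left_mono mult_mono) auto
      also have "\<dots> = 1 / (d\<^sup>2 * T) * integral {0..T} ?w" using LT by (simp add: mult.assoc[symmetric])
      finally show "integral {0..B} (\<lambda>s. (0 - cutoff d T s)\<^sup>2 * ?w s)
        \<le> 1 / (d\<^sup>2 * T) * integral {0..T} ?w" by simp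
    qed
  qed
qed

subsection \<open>Rotations and orthogonality of monomials\<close>

lemma measurable_Complex [measurable (raw)]:
  assumes "f \<in> borel_measurable M" "g \<in> borel_measurable M"
  shows "(\<lambda>x. Complex (f x) (g x)) \<in> borel_measurable M"
  using assms unfolding Complex_eq by measurable

lemma distr_lborel_Complex: "distr lborel borel (\<lambda>(x, y). Complex x y) = lborel"
proof (rule lborel_eqI[symmetric])
  fix l u :: complex
  assume "\<And>b. b \<in> Basis \<Longrightarrow> l \<bullet> b \<le> u \<bullet> b"
  from this[of 1] this[of \<i>] have le: "Re l \<le> Re u" "Im l \<le> Im u"
    by (simp_all add: Basis_complex_def inner_complex_def)
  have vim: "(\<lambda>(x, y). Complex x y) -` box l u = box (Re l) (Re u) \<times> box (Im l) (Im u)"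
    by (auto simp: box_def Basis_complex_def inner_complex_def)
  have [measurable]: "(\<lambda>(x, y). Complex x y) \<in> borel \<rightarrow>\<^sub>M borel"
    unfolding borel_prod[symmetric] by measurable
  have "emeasure (distr lborel borel (\<lambda>(x, y). Complex x y)) (box l u)
      = emeasure (lborel \<Otimes>\<^sub>M lborel) (box (Re l) (Re u) \<times> box (Im l) (Im u))"
    by (subst emeasure_distr) (simp_all add: vim lborel_prod)
  also have "\<dots> = ennreal (Re u - Re l) * ennreal (Im u - Im l)"
    using le by (subst lborel.emeasure_pair_measure_Times) (auto simp: emeasure_lborel_box_eq)
  also have "\<dots> = (\<Prod>b\<in>Basis. (u - l) \<bullet> b)"
    using le by (simp add: Basis_complex_def inner_complex_def ennreal_mult complex_eq_iff)
  finally show "emeasure (distr lborel borel (\<lambda>(x, y). Complex x y)) (box l u) = (\<Prod>b\<in>Basis. (u - l) \<bullet> b)" .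
qed simp

lemma nn_integral_complex_iterated:
  fixes g :: "complex \<Rightarrow> ennreal"
  assumes [measurable]: "g \<in> borel_measurable borel"
  shows "(\<integral>\<^sup>+ z. g z \<partial>lborel) = (\<integral>\<^sup>+ x. \<integral>\<^sup>+ y. g (Complex x y) \<partial>lborel \<partial>lborel)" (is "_ = ?A")
    and "(\<integral>\<^sup>+ z. g z \<partial>lborel) = (\<integral>\<^sup>+ y. \<integral>\<^sup>+ x. g (Complex x y) \<partial>lborel \<partial>lborel)" (is "_ = ?B")
proof -
  have "(\<integral>\<^sup>+ z. g z \<partial>lborel) = (\<integral>\<^sup>+ z. g z \<partial>distr (lborel :: (real \<times> real) measure) borel (\<lambda>(x, y). Complex x y))"
    by (simp only: distr_lborel_Complex)
  also have "\<dots> = (\<integral>\<^sup>+ (x, y). g (Complex x y) \<partial>(lborel \<Otimes>\<^sub>M lborel))"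
    by (subst nn_integral_distr)
      (simp_all add: case_prod_unfold lborel_prod[symmetric] cong: measurable_cong_sets)
  finally have eq: "(\<integral>\<^sup>+ z. g z \<partial>lborel) = (\<integral>\<^sup>+ (x, y). g (Complex x y) \<partial>(lborel \<Otimes>\<^sub>M lborel))" .
  show "(\<integral>\<^sup>+ z. g z \<partial>lborel) = ?A"
    unfolding eq by (subst lborel.nn_integral_fst[symmetric]) simp_all
  show "(\<integral>\<^sup>+ z. g z \<partial>lborel) = ?B"
    unfolding eq by (subst lborel_pair.nn_integral_snd[symmetric]) simp_all
qed

text \<open>Along each line parallel to the fixed axis a shear is a translation, so it is absorbed
  by the inner integral; this is why both orders of iterated integration are provided.\<close>

lemma nn_integral_lborel_shear:
  fixes g :: "complex \<Rightarrow> ennreal"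
  assumes [measurable]: "g \<in> borel_measurable borel"
  shows "(\<integral>\<^sup>+ z. g (Complex (Re z + t * Im z) (Im z)) \<partial>lborel) = (\<integral>\<^sup>+ z. g z \<partial>lborel)"
    and "(\<integral>\<^sup>+ z. g (Complex (Re z) (Im z + t * Re z)) \<partial>lborel) = (\<integral>\<^sup>+ z. g z \<partial>lborel)"
proof -
  have shift: "(\<integral>\<^sup>+ x. h (x + a) \<partial>lborel) = (\<integral>\<^sup>+ x. h x \<partial>lborel)"
    if "h \<in> borel_measurable borel" for h :: "real \<Rightarrow> ennreal" and a
    using nn_integral_real_affine[OF that, of 1 a] by (simp add: add.commute)
  show "(\<integral>\<^sup>+ z. g (Complex (Re z + t * Im z) (Im z)) \<partial>lborel) = (\<integral>\<^sup>+ z. g z \<partial>lborel)"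
    by (simp add: nn_integral_complex_iterated(2) shift[of "\<lambda>x. g (Complex x _)"])
  show "(\<integral>\<^sup>+ z. g (Complex (Re z) (Im z + t * Re z)) \<partial>lborel) = (\<integral>\<^sup>+ z. g z \<partial>lborel)"
    by (simp add: nn_integral_complex_iterated(1) shift[of "\<lambda>y. g (Complex _ y)"])
qed

text \<open>A rotation by an angle other than \<open>\<pi>\<close> is a product of three shears.\<close>

lemma nn_integral_lborel_rotate:
  fixes g :: "complex \<Rightarrow> ennreal"
  assumes g: "g \<in> borel_measurable borel" and w: "cmod w = 1"
  shows "(\<integral>\<^sup>+ z. g (w * z) \<partial>lborel) = (\<integral>\<^sup>+ z. g z \<partial>lborel)"
proof -
  have rot: "(\<integral>\<^sup>+ z. g (w * z) \<partial>lborel) = (\<integral>\<^sup>+ z. g z \<partial>lborel)"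
    if w: "cmod w = 1" "Re w \<noteq> -1" and g: "g \<in> borel_measurable borel"
    for w and g :: "complex \<Rightarrow> ennreal"
  proof -
    note [measurable] = g
    \<comment> \<open>For a rotation by the angle theta, t = -tan(theta/2). The rotation is the
      horizontal shear by \<open>t\<close>, then the vertical shear by \<open>s\<close>, then the
      horizontal shear by \<open>t\<close> again; t has its pole exactly at the half turn.\<close>
    define c s t where "c = Re w" and "s = Im w" and "t = - s / (1 + c)"
    have cs: "c\<^sup>2 + s\<^sup>2 = 1" using w(1) unfolding c_def s_def by (metis cmod_power2 one_power2)
    have c1: "1 + c \<noteq> 0" using w(2) by (auto simp: c_def)
    have 1: "1 + t * s = c" using cs c1 by (simp add: t_def field_simps power2_eq_square)
    have "t * (1 + c) = - s" using c1 by (simp add: t_def)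
    then have 2: "t + t * c = - s" by (simp add: algebra_simps)
    have wz: "w * z = Complex (x' + t * y') y'"
      if "x' = Re z + t * Im z" "y' = Im z + s * x'" for z x' y'
    proof (rule complex_eqI)
      have "x' + t * y' = (1 + t * s) * Re z + (t + t * (1 + t * s)) * Im z"
        using that by (simp add: algebra_simps)
      also have "\<dots> = c * Re z - s * Im z" unfolding 1 2 by simp
      finally show "Re (w * z) = Re (Complex (x' + t * y') y')" by (simp add: c_def s_def)
      have "y' = s * Re z + (1 + t * s) * Im z" using that by (simp add: algebra_simps)
      then show "Im (w * z) = Im (Complex (x' + t * y') y')"
        unfolding 1 by (simp add: c_def s_def algebra_simps)
    qed
    let ?X = "\<lambda>z. Complex (Re z + t * Im z) (Im z)" and ?Y = "\<lambda>z. Complex (Re z) (Im z + s * Re z)"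
    have "(\<integral>\<^sup>+ z. g (w * z) \<partial>lborel) = (\<integral>\<^sup>+ z. g (?X (?Y (?X z))) \<partial>lborel)"
      by (rule nn_integral_cong) (subst wz[OF refl refl], simp)
    also have "\<dots> = (\<integral>\<^sup>+ z. g (?X (?Y z)) \<partial>lborel)"
      by (rule nn_integral_lborel_shear(1)[of "\<lambda>z. g (?X (?Y z))"]) measurable
    also have "\<dots> = (\<integral>\<^sup>+ z. g (?X z) \<partial>lborel)"
      by (rule nn_integral_lborel_shear(2)[of "\<lambda>z. g (?X z)"]) measurable
    also have "\<dots> = (\<integral>\<^sup>+ z. g z \<partial>lborel)"
      by (rule nn_integral_lborel_shear(1)) measurable
    finally show ?thesis .
  qed
  show ?thesis
  proof (cases "Re w = -1")
    case True
    \<comment> \<open>The half turn is split into two quarter turns, to each of which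
      \<open>rot\<close> applies.\<close>
    have "(cmod w)\<^sup>2 = (Re w)\<^sup>2 + (Im w)\<^sup>2" by (rule cmod_power2)
    then have "w = \<i> * \<i>" using w True by (simp add: complex_eq_iff)
    then have "(\<integral>\<^sup>+ z. g (w * z) \<partial>lborel) = (\<integral>\<^sup>+ z. g (\<i> * (\<i> * z)) \<partial>lborel)"
      by (simp add: mult.assoc)
    also have "\<dots> = (\<integral>\<^sup>+ z. g (\<i> * z) \<partial>lborel)"
      using g by (intro rot[of \<i> "\<lambda>z. g (\<i> * z)"]) auto
    also have "\<dots> = (\<integral>\<^sup>+ z. g z \<partial>lborel)" using g by (intro rot) auto
    finally show ?thesis .
  qed (use rot g w in auto)
qed

section \<open>The normalised area in the variable s = |z|^2\<close>

lemma sets_area [measurable_cong, simp]: "sets area = sets borel"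
  by (simp add: area_def)

lemma space_area [simp]: "space area = UNIV"
  by (simp add: area_def space_scale_measure)

lemma nn_integral_area:
  assumes "g \<in> borel_measurable borel"
  shows "(\<integral>\<^sup>+ z. g z \<partial>area) = ennreal (1 / pi) * (\<integral>\<^sup>+ z. g z \<partial>lborel)"
  unfolding area_def using assms by (subst nn_integral_scale_measure) auto

lemma nn_integral_area_rotate:
  assumes [measurable]: "g \<in> borel_measurable borel" and "cmod w = 1"
  shows "(\<integral>\<^sup>+ z. g (w * z) \<partial>area) = (\<integral>\<^sup>+ z. g z \<partial>area)"
  using assms by (simp add: nn_integral_area nn_integral_lborel_rotate)

text \<open>The closed disc |z|^2 \<le> t has Euclidean area pi t, hence normalised area t, for
  nonnegative t; for negative t both measures give 0. Agreement on the half lines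
  \<open>{..t}\<close> determines the measure.\<close>

lemma distr_area_norm_square:
  "distr area borel (\<lambda>z. (cmod z)\<^sup>2) = density lborel (indicator {0..})"
proof (rule measure_eqI_generator_eq)
  let ?E = "range (atMost :: real \<Rightarrow> real set)"
  show "Int_stable ?E" by (auto simp: Int_stable_def)
  show "?E \<subseteq> Pow UNIV" "range (\<lambda>i::nat. {..real i}) \<subseteq> ?E" by auto
  show "(\<Union>i::nat. {..real i}) = UNIV" using real_arch_simple by auto
  have eq: "emeasure (distr area borel (\<lambda>z. (cmod z)\<^sup>2)) {..t} = ennreal t"
    "emeasure (density lborel (indicator {0..})) {..t} = ennreal t" for t :: real
  proof -
    have "emeasure (density lborel (indicator {0..})) {..t} = emeasure lborel ({0..} \<inter> {..t})"
      by (subst emeasure_density) (auto simp: indicator_inter_arith[symmetric])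
    also have "{0..} \<inter> {..t} = {0..t}" by auto
    finally show "emeasure (density lborel (indicator {0..})) {..t} = ennreal t"
      by (cases "0 \<le> t") (auto simp: ennreal_neg)
    have "emeasure (distr area borel (\<lambda>z. (cmod z)\<^sup>2)) {..t} = emeasure area ((\<lambda>z. (cmod z)\<^sup>2) -` {..t})"
      by (subst emeasure_distr) auto
    also have "\<dots> = ennreal t"
    proof (cases "0 \<le> t")
      case True
      have "(\<lambda>z::complex. (cmod z)\<^sup>2) -` {..t} = cball 0 (sqrt t)"
        using True by (auto simp: real_le_rsqrt sqrt_le_D real_sqrt_le_iff' intro: real_le_rsqrt)
          (metis norm_ge_zero real_sqrt_le_iff' real_sqrt_ge_zero power2_eq_square real_sqrt_pow2 power_mono)
      then have "emeasure area ((\<lambda>z. (cmod z)\<^sup>2) -` {..t}) = ennreal (1 / pi) * emeasure lborel (cball 0 (sqrt t) :: complex set)"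
        by (simp add: area_def emeasure_scale_measure)
      also have "\<dots> = ennreal t"
        using True by (subst emeasure_cball) (auto simp: eval_unit_ball_vol ennreal_mult[symmetric])
      finally show ?thesis .
    next
      case False
      then have "(\<lambda>z::complex. (cmod z)\<^sup>2) -` {..t} = {}"
        by auto (metis False order_trans zero_le_power2)
      then show ?thesis using False by (simp add: ennreal_neg)
    qed
    finally show "emeasure (distr area borel (\<lambda>z. (cmod z)\<^sup>2)) {..t} = ennreal t" .
  qed
  show "emeasure (distr area borel (\<lambda>z. (cmod z)\<^sup>2)) X = emeasure (density lborel (indicator {0..})) X"
    if "X \<in> ?E" for X
    using that eq by auto
  show "emeasure (distr area borel (\<lambda>z. (cmod z)\<^sup>2)) {..real i} \<noteq> \<infinity>" for i :: nat
    unfolding eq by simp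
qed (auto simp: borel_eq_atMost)

lemma nn_integral_area_radial:
  fixes F :: "real \<Rightarrow> ennreal"
  assumes [measurable]: "F \<in> borel_measurable borel"
  shows "(\<integral>\<^sup>+ z. F ((cmod z)\<^sup>2) \<partial>area) = (\<integral>\<^sup>+ s\<in>{0..}. F s \<partial>lborel)"
proof -
  have "(\<integral>\<^sup>+ z. F ((cmod z)\<^sup>2) \<partial>area) = (\<integral>\<^sup>+ s. F s \<partial>distr area borel (\<lambda>z. (cmod z)\<^sup>2))"
    by (subst nn_integral_distr) auto
  also have "\<dots> = (\<integral>\<^sup>+ s\<in>{0..}. F s \<partial>lborel)"
    unfolding distr_area_norm_square by (subst nn_integral_density) (auto simp: mult.commute)
  finally show ?thesis .
qed

text \<open>Orthogonality of the characters of Z/N: expanding the squared modulus and summing over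
  \<open>j\<close> first leaves geometric sums of N-th roots of unity, which vanish off the
  diagonal.\<close>

lemma discrete_parseval:
  fixes b :: "nat \<Rightarrow> complex" and N :: nat
  assumes "0 < N"
  defines "w \<equiv> cis (2 * pi / real N)"
  shows "(\<Sum>j<N. (cmod (\<Sum>n<N. b n * w ^ (j * n)))\<^sup>2) = real N * (\<Sum>n<N. (cmod (b n))\<^sup>2)"
proof -
  have orth: "(\<Sum>j<N. w ^ (j * n) * cnj (w ^ (j * k))) = (if n = k then of_nat N else 0)"
    if "n < N" "k < N" for n k
  proof -
    define u where "u = cis (2 * pi * (real n - real k) / real N)"
    have pw: "w ^ (j * n) * cnj (w ^ (j * k)) = u ^ j" for j
      unfolding w_def u_def complex_cnj_power cis_cnj unfolding Complex.DeMoivre cis_mult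
      by (rule arg_cong[where f = cis]) (use assms(1) in \<open>simp add: field_simps\<close>)
    show ?thesis
    proof (cases "n = k")
      case True
      then show ?thesis unfolding pw by (simp add: u_def)
    next
      case False
      \<comment> \<open>Otherwise N would divide n - k, which is impossible for distinct indices
        below N.\<close>
      have "u \<noteq> 1"
      proof
        assume "u = 1"
        then obtain i :: int where "2 * pi * (real n - real k) / real N = of_int i * (2 * pi)"
          unfolding u_def cis_eq_1_iff by blast
        then have "2 * pi * ((real n - real k) / real N) = 2 * pi * of_int i" by simp
        then have "(real n - real k) / real N = of_int i"
          by (simp only: mult_cancel_left) simp
        then have "real_of_int (int n - int k) = real_of_int (i * int N)"
          using assms(1) by (simp add: field_simps)
        then have i: "int n - int k = i * int N" by (simp only: of_int_eq_iff)
        have "\<bar>int n - int k\<bar> < int N" using that by linarith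
        with i have "\<bar>i\<bar> * int N < 1 * int N" by (simp add: abs_mult)
        then have "\<bar>i\<bar> < 1" by (rule mult_right_less_imp_less) simp
        with i False show False by simp
      qed
      moreover have "u ^ N = 1"
        using assms(1) by (simp add: u_def Complex.DeMoivre cis_eq_1_iff)
      ultimately show ?thesis using False unfolding pw by (simp add: sum_gp_strict)
    qed
  qed
  have "complex_of_real (\<Sum>j<N. (cmod (\<Sum>n<N. b n * w ^ (j * n)))\<^sup>2)
      = (\<Sum>j<N. \<Sum>n<N. \<Sum>k<N. b n * cnj (b k) * (w ^ (j * n) * cnj (w ^ (j * k))))"
    by (simp add: complex_norm_square sum_product mult_ac del: of_real_power)
  also have "\<dots> = (\<Sum>n<N. \<Sum>k<N. b n * cnj (b k) * (\<Sum>j<N. w ^ (j * n) * cnj (w ^ (j * k))))"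
    unfolding sum_distrib_left
    by (subst sum.swap, rule sum.cong[OF refl], subst sum.swap) simp
  also have "\<dots> = (\<Sum>n<N. \<Sum>k<N. if n = k then b n * cnj (b k) * of_nat N else 0)"
    by (intro sum.cong refl) (auto simp: orth simp del: complex_cnj_power)
  also have "\<dots> = complex_of_real (real N * (\<Sum>n<N. (cmod (b n))\<^sup>2))"
    by (simp add: complex_norm_square sum_distrib_left mult_ac del: of_real_power)
  finally show ?thesis by (simp only: of_real_eq_iff)
qed

text \<open>Averaging over the rotations by \<open>N\<close>-th roots of unity gives the orthogonality of the
  terms without any integrability assumption.\<close>

lemma nn_integral_area_parseval:
  fixes c :: "nat \<Rightarrow> real \<Rightarrow> complex" and N :: nat
  assumes [measurable]: "\<And>n. c n \<in> borel_measurable borel"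
  shows "(\<integral>\<^sup>+ z. ennreal ((cmod (\<Sum>n<N. c n ((cmod z)\<^sup>2) * z ^ n))\<^sup>2) \<partial>area)
    = (\<Sum>n<N. \<integral>\<^sup>+ s\<in>{0..}. ennreal ((cmod (c n s))\<^sup>2 * s ^ n) \<partial>lborel)"
proof (cases "N = 0")
  case False
  then have "0 < N" by simp
  define w where "w = cis (2 * pi / real N)"
  define Q where "Q z = (\<Sum>n<N. c n ((cmod z)\<^sup>2) * z ^ n)" for z
  have [measurable]: "Q \<in> borel_measurable borel" unfolding Q_def by measurable
  have Qw: "Q (w ^ j * z) = (\<Sum>n<N. (c n ((cmod z)\<^sup>2) * z ^ n) * w ^ (j * n))" for j z
    unfolding power_mult by (simp add: Q_def norm_mult norm_power w_def power_mult_distrib mult_ac)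
  \<comment> \<open>By rotation invariance each of the N rotated integrals equals the original one,
    so the average can be taken under the integral sign.\<close>
  have "of_nat N * (\<integral>\<^sup>+ z. ennreal ((cmod (Q z))\<^sup>2) \<partial>area)
      = (\<Sum>j<N. \<integral>\<^sup>+ z. ennreal ((cmod (Q (w ^ j * z)))\<^sup>2) \<partial>area)"
    by (subst nn_integral_area_rotate[where g = "\<lambda>z. ennreal ((cmod (Q z))\<^sup>2)"])
      (simp_all add: norm_power w_def)
  also have "\<dots> = (\<integral>\<^sup>+ z. ennreal (\<Sum>j<N. (cmod (Q (w ^ j * z)))\<^sup>2) \<partial>area)"
    by (subst nn_integral_sum[symmetric]) (auto simp: sum_ennreal)
  \<comment> \<open>Rotation leaves the radial coefficients alone, so at each fixed z
    \<open>discrete_parseval\<close> applies with coefficients c_n(|z|^2) z^n; the cross terms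
    cancel pointwise, before integration.\<close>
  also have "\<dots> = (\<integral>\<^sup>+ z. of_nat N * (\<Sum>n<N. ennreal ((cmod (c n ((cmod z)\<^sup>2)))\<^sup>2 * ((cmod z)\<^sup>2) ^ n)) \<partial>area)"
    unfolding Qw unfolding w_def discrete_parseval[OF \<open>0 < N\<close>]
    by (simp add: ennreal_mult ennreal_of_nat_eq_real_of_nat sum_nonneg norm_mult norm_power
        power_mult_distrib power_mult[symmetric] mult.commute flip: sum_ennreal)
  also have "\<dots> = of_nat N * (\<Sum>n<N. \<integral>\<^sup>+ z. ennreal ((cmod (c n ((cmod z)\<^sup>2)))\<^sup>2 * ((cmod z)\<^sup>2) ^ n) \<partial>area)"
    by (simp add: nn_integral_cmult nn_integral_sum del: sum_ennreal)
  also have "\<dots> = of_nat N * (\<Sum>n<N. \<integral>\<^sup>+ s\<in>{0..}. ennreal ((cmod (c n s))\<^sup>2 * s ^ n) \<partial>lborel)"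
    by (subst nn_integral_area_radial[where F = "\<lambda>s. ennreal ((cmod (c _ s))\<^sup>2 * s ^ _)"]) simp_all
  finally show ?thesis
    using False unfolding Q_def by (subst (asm) ennreal_mult_cancel_left) auto
qed simp

subsection \<open>Truncating polynomials\<close>

lemma nn_integral_Icc_eq_integral:
  fixes h :: "real \<Rightarrow> real"
  assumes "continuous_on {a..b} h" "\<And>s. s \<in> {a..b} \<Longrightarrow> 0 \<le> h s"
  shows "(\<integral>\<^sup>+ s\<in>{a..b}. ennreal (h s) \<partial>lborel) = ennreal (integral {a..b} h)"
  using assms by (intro nn_integral_has_integral_lebesgue')
    (auto intro!: integrable_integral integrable_continuous_real)

text \<open>Monotone convergence along \<open>{a..a + real i}\<close> carries bounds uniform in the
  right endpoint over to the half line.\<close>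

lemma nn_integral_atLeast_le:
  fixes g :: "real \<Rightarrow> ennreal"
  assumes [measurable]: "g \<in> borel_measurable borel"
    and le: "\<And>B. a \<le> B \<Longrightarrow> (\<integral>\<^sup>+ s\<in>{a..B}. g s \<partial>lborel) \<le> K"
  shows "(\<integral>\<^sup>+ s\<in>{a..}. g s \<partial>lborel) \<le> K"
proof -
  have SUP: "(SUP i::nat. g s * indicator {a..a + real i} s) = g s * indicator {a..} s" for s
  proof (rule antisym)
    show "(SUP i::nat. g s * indicator {a..a + real i} s) \<le> g s * indicator {a..} s"
      by (rule SUP_least) (auto simp: indicator_def)
    obtain i :: nat where "s - a \<le> real i" using real_arch_simple by blast
    then have "g s * indicator {a..} s \<le> g s * indicator {a..a + real i} s"
      by (auto simp: indicator_def)
    then show "g s * indicator {a..} s \<le> (SUP i::nat. g s * indicator {a..a + real i} s)"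
      by (rule SUP_upper2[OF UNIV_I])
  qed
  have "(\<integral>\<^sup>+ s\<in>{a..}. g s \<partial>lborel) = (SUP i::nat. \<integral>\<^sup>+ s\<in>{a..a + real i}. g s \<partial>lborel)"
    unfolding SUP[symmetric]
    by (rule nn_integral_monotone_convergence_SUP)
      (auto simp: incseq_def le_fun_def indicator_def)
  also have "\<dots> \<le> K" by (intro SUP_least le) auto
  finally show ?thesis .
qed

text \<open>The bound of \<open>cutoff_multiplier\<close> is uniform in \<open>B\<close>, so it
  survives on the half line. The interval on the right is half open to match the open disc when T =
  R^2.\<close>

lemma cutoff_multiplier_nn_integral:
  fixes n :: nat and d T :: real
  assumes d: "0 < d" "d < 1" and T: "1 / d\<^sup>2 \<le> T"
  obtains m :: real where
    "(\<integral>\<^sup>+ s\<in>{0..}. ennreal ((m - cutoff d T s)\<^sup>2 * (s ^ n * exp (- 2 * s))) \<partial>lborel)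
      \<le> ennreal (1 / (d\<^sup>2 * T)) * (\<integral>\<^sup>+ s\<in>{0..<T}. ennreal (s ^ n * exp (- 2 * s)) \<partial>lborel)"
proof -
  obtain m where m: "\<And>B. 0 \<le> B \<Longrightarrow> integral {0..B} (\<lambda>s. (m - cutoff d T s)\<^sup>2 * (s ^ n * exp (- 2 * s)))
      \<le> 1 / (d\<^sup>2 * T) * integral {0..T} (\<lambda>s. s ^ n * exp (- 2 * s))"
    using cutoff_multiplier[OF assms] by blast
  have "0 < 1 / d\<^sup>2" using d by simp
  with T have T0: "0 < T" by linarith
  show thesis
  proof (rule that[of m], rule nn_integral_atLeast_le)
    fix B :: real assume B: "0 \<le> B"
    have "(\<integral>\<^sup>+ s\<in>{0..B}. ennreal ((m - cutoff d T s)\<^sup>2 * (s ^ n * exp (- 2 * s))) \<partial>lborel)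
        = ennreal (integral {0..B} (\<lambda>s. (m - cutoff d T s)\<^sup>2 * (s ^ n * exp (- 2 * s))))"
      by (rule nn_integral_Icc_eq_integral) (auto intro!: continuous_intros)
    also have "\<dots> \<le> ennreal (1 / (d\<^sup>2 * T) * integral {0..T} (\<lambda>s. s ^ n * exp (- 2 * s)))"
      by (rule ennreal_leI[OF m[OF B]])
    also have "\<dots> = ennreal (1 / (d\<^sup>2 * T)) * ennreal (integral {0..T} (\<lambda>s. s ^ n * exp (- 2 * s)))"
      using T0 by (intro ennreal_mult integral_nonneg integrable_continuous_real continuous_intros) auto
    also have "ennreal (integral {0..T} (\<lambda>s. s ^ n * exp (- 2 * s)))
        = (\<integral>\<^sup>+ s\<in>{0..T}. ennreal (s ^ n * exp (- 2 * s)) \<partial>lborel)"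
      by (rule nn_integral_Icc_eq_integral[symmetric]) (auto intro!: continuous_intros)
    also have "\<dots> = (\<integral>\<^sup>+ s\<in>{0..<T}. ennreal (s ^ n * exp (- 2 * s)) \<partial>lborel)"
    proof (rule nn_integral_cong_AE)
      show "AE s in lborel. ennreal (s ^ n * exp (- 2 * s)) * indicator {0..T} s
          = ennreal (s ^ n * exp (- 2 * s)) * indicator {0..<T} s"
        using AE_lborel_singleton[of T] by eventually_elim (auto simp: indicator_def)
    qed
    finally show "(\<integral>\<^sup>+ s\<in>{0..B}. ennreal ((m - cutoff d T s)\<^sup>2 * (s ^ n * exp (- 2 * s))) \<partial>lborel)
      \<le> ennreal (1 / (d\<^sup>2 * T)) * (\<integral>\<^sup>+ s\<in>{0..<T}. ennreal (s ^ n * exp (- 2 * s)) \<partial>lborel)" .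
  qed measurable
qed

lemma mem_ball_0_iff_norm_square:
  fixes z :: complex
  assumes "0 < R"
  shows "z \<in> ball 0 R \<longleftrightarrow> (cmod z)\<^sup>2 < R\<^sup>2"
  using assms power_mono_iff[of R "cmod z" 2] by (simp flip: not_le)

text \<open>By orthogonality both sides split into sums over n of |a_n|^2 times one-dimensional
  integrals, and these are compared term by term using the multiplier for each n.\<close>

lemma polynomial_cutoff:
  fixes p :: "complex poly"
  assumes d: "0 < d" "d < 1" and R: "0 < R" "1 / d\<^sup>2 \<le> R\<^sup>2"
  obtains q where
    "(\<integral>\<^sup>+ z. ennreal ((cmod (poly q z - cutoff d (R\<^sup>2) ((cmod z)\<^sup>2) * poly p z) * exp (- (cmod z)\<^sup>2))\<^sup>2) \<partial>area)
     \<le> ennreal (1 / (d\<^sup>2 * R\<^sup>2)) * (\<integral>\<^sup>+ z\<in>ball 0 R. ennreal ((cmod (poly p z) * exp (- (cmod z)\<^sup>2))\<^sup>2) \<partial>area)"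
proof -
  let ?w = "\<lambda>n s::real. s ^ n * exp (- 2 * s)"
  let ?\<chi> = "cutoff d (R\<^sup>2)"
  define N where "N = Suc (degree p)"
  have p: "poly p z = (\<Sum>n<N. coeff p n * z ^ n)" for z
    by (simp add: poly_altdef N_def lessThan_Suc_atMost)
  have "\<forall>n. \<exists>m. (\<integral>\<^sup>+ s\<in>{0..}. ennreal ((m - ?\<chi> s)\<^sup>2 * ?w n s) \<partial>lborel)
      \<le> ennreal (1 / (d\<^sup>2 * R\<^sup>2)) * (\<integral>\<^sup>+ s\<in>{0..<R\<^sup>2}. ennreal (?w n s) \<partial>lborel)"
  proof
    fix n
    show "\<exists>m. (\<integral>\<^sup>+ s\<in>{0..}. ennreal ((m - ?\<chi> s)\<^sup>2 * ?w n s) \<partial>lborel)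
      \<le> ennreal (1 / (d\<^sup>2 * R\<^sup>2)) * (\<integral>\<^sup>+ s\<in>{0..<R\<^sup>2}. ennreal (?w n s) \<partial>lborel)"
      by (rule cutoff_multiplier_nn_integral[OF d R(2), of n]) blast
  qed
  from choice[OF this] obtain m where m: "\<And>n. (\<integral>\<^sup>+ s\<in>{0..}. ennreal ((m n - ?\<chi> s)\<^sup>2 * ?w n s) \<partial>lborel)
      \<le> ennreal (1 / (d\<^sup>2 * R\<^sup>2)) * (\<integral>\<^sup>+ s\<in>{0..<R\<^sup>2}. ennreal (?w n s) \<partial>lborel)"
    by blast
  define q where "q = (\<Sum>n<N. monom (of_real (m n) * coeff p n) n)"
  have expsq: "(exp (- s))\<^sup>2 = exp (- 2 * s)" for s :: real
    by (simp flip: exp_double)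
  \<comment> \<open>Stated for arbitrary radial multipliers \<open>b\<close>, as it serves twice:
    with the error \<open>m n\<close> minus the cutoff, and with the indicator of the disc. The
    Gaussian factor is moved into the coefficients \<open>c\<close>, where its square becomes
    e^(-2s).\<close>
  have radial: "(\<integral>\<^sup>+ z. ennreal ((cmod (\<Sum>n<N. of_real (b n ((cmod z)\<^sup>2)) * coeff p n * z ^ n) * exp (- (cmod z)\<^sup>2))\<^sup>2) \<partial>area)
      = (\<Sum>n<N. ennreal ((cmod (coeff p n))\<^sup>2) * (\<integral>\<^sup>+ s\<in>{0..}. ennreal ((b n s)\<^sup>2 * ?w n s) \<partial>lborel))"
    if [measurable]: "\<And>n. b n \<in> borel_measurable borel" for b :: "nat \<Rightarrow> real \<Rightarrow> real"
  proof -
    define c where "c n s = of_real (b n s) * coeff p n * of_real (exp (- s))" for n s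
    have [measurable]: "c n \<in> borel_measurable borel" for n unfolding c_def by measurable
    have "(\<integral>\<^sup>+ z. ennreal ((cmod (\<Sum>n<N. of_real (b n ((cmod z)\<^sup>2)) * coeff p n * z ^ n) * exp (- (cmod z)\<^sup>2))\<^sup>2) \<partial>area)
      = (\<integral>\<^sup>+ z. ennreal ((cmod (\<Sum>n<N. c n ((cmod z)\<^sup>2) * z ^ n))\<^sup>2) \<partial>area)"
    proof (rule nn_integral_cong)
      fix z
      have "(\<Sum>n<N. c n ((cmod z)\<^sup>2) * z ^ n)
          = (\<Sum>n<N. of_real (b n ((cmod z)\<^sup>2)) * coeff p n * z ^ n) * of_real (exp (- (cmod z)\<^sup>2))"
        by (simp add: c_def sum_distrib_left sum_distrib_right mult_ac)
      then show "ennreal ((cmod (\<Sum>n<N. of_real (b n ((cmod z)\<^sup>2)) * coeff p n * z ^ n) * exp (- (cmod z)\<^sup>2))\<^sup>2)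
          = ennreal ((cmod (\<Sum>n<N. c n ((cmod z)\<^sup>2) * z ^ n))\<^sup>2)"
        by (simp add: norm_mult)
    qed
    also have "\<dots> = (\<Sum>n<N. \<integral>\<^sup>+ s\<in>{0..}. ennreal ((cmod (c n s))\<^sup>2 * s ^ n) \<partial>lborel)"
      by (rule nn_integral_area_parseval) measurable
    also have "\<dots> = (\<Sum>n<N. ennreal ((cmod (coeff p n))\<^sup>2) * (\<integral>\<^sup>+ s\<in>{0..}. ennreal ((b n s)\<^sup>2 * ?w n s) \<partial>lborel))"
    proof (rule sum.cong[OF refl])
      fix n
      have "cmod (c n s) = \<bar>b n s\<bar> * cmod (coeff p n) * exp (- s)" for s
        by (simp add: c_def norm_mult)
      then have "(cmod (c n s))\<^sup>2 * s ^ n = (cmod (coeff p n))\<^sup>2 * ((b n s)\<^sup>2 * ?w n s)" for s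
        by (simp only: power_mult_distrib expsq power2_abs mult_ac)
      then show "(\<integral>\<^sup>+ s\<in>{0..}. ennreal ((cmod (c n s))\<^sup>2 * s ^ n) \<partial>lborel)
          = ennreal ((cmod (coeff p n))\<^sup>2) * (\<integral>\<^sup>+ s\<in>{0..}. ennreal ((b n s)\<^sup>2 * ?w n s) \<partial>lborel)"
        by (subst nn_integral_cmult[symmetric])
          (simp_all only: ennreal_mult'[OF zero_le_power2] mult.assoc, measurable)
    qed
    finally show ?thesis .
  qed
  have diff: "poly q z - ?\<chi> ((cmod z)\<^sup>2) * poly p z
      = (\<Sum>n<N. of_real (m n - ?\<chi> ((cmod z)\<^sup>2)) * coeff p n * z ^ n)" for z
    unfolding q_def poly_sum poly_monom p sum_distrib_left sum_subtractf[symmetric]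
    by (rule sum.cong) (simp_all add: left_diff_distrib mult.assoc)
  have "(\<integral>\<^sup>+ z. ennreal ((cmod (poly q z - ?\<chi> ((cmod z)\<^sup>2) * poly p z) * exp (- (cmod z)\<^sup>2))\<^sup>2) \<partial>area)
      = (\<Sum>n<N. ennreal ((cmod (coeff p n))\<^sup>2) * (\<integral>\<^sup>+ s\<in>{0..}. ennreal ((m n - ?\<chi> s)\<^sup>2 * ?w n s) \<partial>lborel))"
    unfolding diff by (rule radial) measurable
  also have "\<dots> \<le> (\<Sum>n<N. ennreal ((cmod (coeff p n))\<^sup>2) *
      (ennreal (1 / (d\<^sup>2 * R\<^sup>2)) * (\<integral>\<^sup>+ s\<in>{0..<R\<^sup>2}. ennreal (?w n s) \<partial>lborel)))"
    by (intro sum_mono mult_left_mono m) auto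
  \<comment> \<open>Restriction to the disc is rewritten as a multiplier, so that
    \<open>radial\<close> can be read backwards to reassemble the norm of \<open>p\<close>.\<close>
  also have "\<dots> = ennreal (1 / (d\<^sup>2 * R\<^sup>2)) * (\<Sum>n<N. ennreal ((cmod (coeff p n))\<^sup>2) *
      (\<integral>\<^sup>+ s\<in>{0..}. ennreal ((indicator {..<R\<^sup>2} s)\<^sup>2 * ?w n s) \<partial>lborel))"
    unfolding sum_distrib_left mult.left_commute[of "ennreal (_\<^sup>2)" "ennreal (1 / (d\<^sup>2 * R\<^sup>2))"]
  proof (intro sum.cong refl)
    fix n
    have "(\<integral>\<^sup>+ s\<in>{0..<R\<^sup>2}. ennreal (?w n s) \<partial>lborel)
        = (\<integral>\<^sup>+ s\<in>{0..}. ennreal ((indicator {..<R\<^sup>2} s)\<^sup>2 * ?w n s) \<partial>lborel)"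
      by (rule nn_integral_cong) (auto split: split_indicator)
    then show "ennreal (1 / (d\<^sup>2 * R\<^sup>2)) *
        (ennreal ((cmod (coeff p n))\<^sup>2) * (\<integral>\<^sup>+ s\<in>{0..<R\<^sup>2}. ennreal (?w n s) \<partial>lborel))
      = ennreal (1 / (d\<^sup>2 * R\<^sup>2)) * (ennreal ((cmod (coeff p n))\<^sup>2) *
          (\<integral>\<^sup>+ s\<in>{0..}. ennreal ((indicator {..<R\<^sup>2} s)\<^sup>2 * ?w n s) \<partial>lborel))"
      by (simp only:)
  qed
  also have "\<dots> = ennreal (1 / (d\<^sup>2 * R\<^sup>2)) *
      (\<integral>\<^sup>+ z. ennreal ((cmod (\<Sum>n<N. of_real (indicator {..<R\<^sup>2} ((cmod z)\<^sup>2)) * coeff p n * z ^ n) * exp (- (cmod z)\<^sup>2))\<^sup>2) \<partial>area)"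
    by (rule arg_cong[OF radial[of "\<lambda>n. indicator {..<R\<^sup>2}", symmetric]]) measurable
  also have "\<dots> = ennreal (1 / (d\<^sup>2 * R\<^sup>2)) *
      (\<integral>\<^sup>+ z\<in>ball 0 R. ennreal ((cmod (poly p z) * exp (- (cmod z)\<^sup>2))\<^sup>2) \<partial>area)"
    by (intro arg_cong2[where f = "(*)"] nn_integral_cong refl)
      (auto simp: p mem_ball_0_iff_norm_square[OF R(1)] simp del: mem_ball mem_ball_0 split: split_indicator)
  finally show thesis by (rule that)
qed

section \<open>Comparing the two discrepancies at a fixed radius\<close>

lemma emeasure_area_annulus:
  assumes "0 \<le> a" "a \<le> b"
  shows "emeasure area {z. a \<le> (cmod z)\<^sup>2 \<and> (cmod z)\<^sup>2 < b} = ennreal (b - a)"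
proof -
  let ?S = "{z. a \<le> (cmod z)\<^sup>2 \<and> (cmod z)\<^sup>2 < b}"
  have "emeasure area ?S = (\<integral>\<^sup>+ z. indicator ?S z \<partial>area)"
    by (rule nn_integral_indicator[symmetric]) simp
  also have "\<dots> = (\<integral>\<^sup>+ z. indicator {a..<b} ((cmod z)\<^sup>2) \<partial>area)"
    by (rule nn_integral_cong) (simp add: indicator_def)
  also have "\<dots> = (\<integral>\<^sup>+ s\<in>{0..}. indicator {a..<b} s \<partial>lborel)"
    by (rule nn_integral_area_radial) measurable
  also have "\<dots> = (\<integral>\<^sup>+ s. indicator {a..<b} s \<partial>lborel)"
    by (rule nn_integral_cong) (use assms in \<open>simp split: split_indicator\<close>)
  also have "\<dots> = ennreal (b - a)" using assms by simp
  finally show ?thesis .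
qed

lemma emeasure_area_ball:
  assumes "0 < R"
  shows "emeasure area (ball 0 R) = ennreal (R\<^sup>2)"
proof -
  have "ball 0 R = {z::complex. 0 \<le> (cmod z)\<^sup>2 \<and> (cmod z)\<^sup>2 < R\<^sup>2}"
    by (rule set_eqI) (simp only: mem_ball_0_iff_norm_square[OF assms] mem_Collect_eq zero_le_power2 simp_thms)
  then show ?thesis using emeasure_area_annulus[of 0 "R\<^sup>2"] by simp
qed

text \<open>Young's inequality, with the large weight 1 + 1/d meant for the correction error and the
  weight 1 + d close to 1 for the main term.\<close>

lemma square_sum_le:
  fixes x y d :: real
  assumes "0 < d"
  shows "(x + y)\<^sup>2 \<le> (1 + 1 / d) * x\<^sup>2 + (1 + d) * y\<^sup>2"
proof -
  have "0 \<le> (x - d * y)\<^sup>2 / d" using assms by simp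
  also have "\<dots> = x\<^sup>2 / d + d * y\<^sup>2 - 2 * x * y"
    using assms by (simp add: power2_eq_square field_simps)
  finally show ?thesis by (simp add: power2_eq_square algebra_simps)
qed

text \<open>By convexity, cutting off costs at most the area of the annulus where the cutoff is not 1.\<close>

lemma Psi_cutoff_le:
  fixes f g :: "complex \<Rightarrow> complex"
  assumes d: "0 < d" "2 * d \<le> 1" and R: "0 < R"
  defines "A \<equiv> {z. (1 - 2 * d) * R\<^sup>2 \<le> (cmod z)\<^sup>2 \<and> (cmod z)\<^sup>2 < R\<^sup>2}"
  shows "Psi g z R \<le> (1 + 1 / d) * (cmod (g z - cutoff d (R\<^sup>2) ((cmod z)\<^sup>2) * f z) * exp (- (cmod z)\<^sup>2))\<^sup>2
    + (1 + d) * (Psi f z R * indicator (ball 0 R) z + indicator A z)"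
proof -
  define c a b h i where "c = cutoff d (R\<^sup>2) ((cmod z)\<^sup>2)" and "a = cmod (f z) * exp (- (cmod z)\<^sup>2)"
    and "b = cmod (g z) * exp (- (cmod z)\<^sup>2)" and "h = cmod (g z - c * f z) * exp (- (cmod z)\<^sup>2)"
    and "i = (indicator (ball 0 R) z :: real)"
  have c: "0 \<le> c" "c \<le> 1" by (simp_all add: c_def cutoff_nonneg cutoff_le_1)
  have T0: "0 < R\<^sup>2" using R by simp
  have "b - c * a = (cmod (g z) - cmod (c * f z)) * exp (- (cmod z)\<^sup>2)"
    using c by (simp add: a_def b_def norm_mult left_diff_distrib)
  then have "\<bar>b - c * a\<bar> = \<bar>cmod (g z) - cmod (c * f z)\<bar> * exp (- (cmod z)\<^sup>2)"
    by (simp add: abs_mult)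
  also have "\<dots> \<le> h" unfolding h_def by (intro mult_right_mono norm_triangle_ineq3) auto
  finally have bh: "(b - c * a)\<^sup>2 \<le> h\<^sup>2" by (simp add: abs_le_square_iff[symmetric])
  have cut: "(c * a - i)\<^sup>2 \<le> Psi f z R * indicator (ball 0 R) z + indicator A z"
  proof (cases "z \<in> ball 0 R")
    case True
    then have i: "i = 1" and z: "(cmod z)\<^sup>2 < R\<^sup>2"
      unfolding i_def by (simp, simp only: mem_ball_0_iff_norm_square[OF R])
    \<comment> \<open>Convexity of x \<mapsto> (x - 1)^2 between 0 and a, in the form of an exact
      identity whose defect c(1 - c)a^2 is then dropped.\<close>
    have "(c * a - 1)\<^sup>2 = c * (a - 1)\<^sup>2 + (1 - c) - c * (1 - c) * a\<^sup>2"
      by (simp add: power2_eq_square algebra_simps)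
    also have "\<dots> \<le> 1 * (a - 1)\<^sup>2 + (1 - c)"
    proof -
      have "0 \<le> c * (1 - c) * a\<^sup>2" using c by (intro mult_nonneg_nonneg) auto
      then show ?thesis using mult_right_mono[OF c(2), of "(a - 1)\<^sup>2"] by simp
    qed
    also have "1 - c \<le> indicator A z"
      using c(1) z cutoff_eq_1[OF d(1) T0, of "(cmod z)\<^sup>2"] by (auto simp: A_def c_def indicator_def)
    finally have "(c * a - 1)\<^sup>2 \<le> (a - 1)\<^sup>2 + indicator A z" by simp
    moreover have "Psi f z R * indicator (ball 0 R) z = (a - 1)\<^sup>2"
      using True by (simp add: Psi_def a_def)
    ultimately show ?thesis by (simp only: i)
  next
    case False
    then have i: "i = 0" and z: "R\<^sup>2 \<le> (cmod z)\<^sup>2"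
      unfolding i_def by (simp, simp only: mem_ball_0_iff_norm_square[OF R] not_less)
    have "(1 - d) * R\<^sup>2 \<le> 1 * R\<^sup>2" using d by (intro mult_right_mono) auto
    then have "c = 0" unfolding c_def using z d T0 by (intro cutoff_eq_0) linarith+
    then show ?thesis using i by (simp add: Psi_def)
  qed
  have "Psi g z R = ((b - c * a) + (c * a - i))\<^sup>2" by (simp add: Psi_def b_def i_def)
  also have "\<dots> \<le> (1 + 1 / d) * (b - c * a)\<^sup>2 + (1 + d) * (c * a - i)\<^sup>2"
    by (rule square_sum_le[OF d(1)])
  also have "\<dots> \<le> (1 + 1 / d) * h\<^sup>2 + (1 + d) * (Psi f z R * indicator (ball 0 R) z + indicator A z)"
    using bh cut d by (intro add_mono mult_left_mono) auto
  finally show ?thesis by (simp add: h_def c_def)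
qed

lemma Psi_nonneg [simp]: "0 \<le> Psi f z R"
  by (simp add: Psi_def)

lemma borel_measurable_Psi [measurable]:
  assumes [measurable]: "f \<in> borel_measurable borel"
  shows "(\<lambda>z. Psi f z R) \<in> borel_measurable borel"
proof -
  have [measurable]: "ball 0 R \<in> sets (borel :: complex measure)" by simp
  show ?thesis unfolding Psi_def by measurable
qed

lemma borel_measurable_poly [measurable]: "poly (p :: complex poly) \<in> borel_measurable borel"
  using continuous_on_poly[OF continuous_on_id, of UNIV p] by (intro borel_measurable_continuous_onI)

text \<open>The assumption \<open>small\<close> bounds the squared norm of \<open>p\<close> over the
  disc by 4R^2, so the correction error is at most 4/d^2, independently of R. For R^2 \<ge> 1/d^4
  even its multiple by 1 + 1/d is of order dR^2, like the area of the annulus.\<close>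

lemma tight_discrepancy_le:
  fixes p :: "complex poly"
  assumes d: "0 < d" "2 * d \<le> 1" and R: "0 < R" "1 / d ^ 4 \<le> R\<^sup>2"
    and small: "(\<integral>\<^sup>+ z\<in>ball 0 R. ennreal (Psi (poly p) z R) \<partial>area) \<le> ennreal (R\<^sup>2)"
  obtains q where "(\<integral>\<^sup>+ z. ennreal (Psi (poly q) z R) \<partial>area)
    \<le> (\<integral>\<^sup>+ z\<in>ball 0 R. ennreal (Psi (poly p) z R) \<partial>area) + ennreal (13 * d * R\<^sup>2)"
proof -
  have "1 / d\<^sup>2 \<le> 1 / d ^ 4" using d by (intro divide_left_mono power_decreasing) auto
  then have R': "1 / d\<^sup>2 \<le> R\<^sup>2" using R(2) by linarith
  define J where "J = (\<integral>\<^sup>+ z\<in>ball 0 R. ennreal (Psi (poly p) z R) \<partial>area)"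
  obtain j where j: "J = ennreal j" "0 \<le> j" "j \<le> R\<^sup>2"
    using small unfolding J_def[symmetric] by (cases J) (auto simp: top_unique)
  define A where "A = {z::complex. (1 - 2 * d) * R\<^sup>2 \<le> (cmod z)\<^sup>2 \<and> (cmod z)\<^sup>2 < R\<^sup>2}"
  have [measurable]: "ball 0 R \<in> sets (borel :: complex measure)" by simp
  have [measurable]: "A \<in> sets borel" unfolding A_def by measurable
  define H where "H q z = (cmod (poly q z - cutoff d (R\<^sup>2) ((cmod z)\<^sup>2) * poly p z) * exp (- (cmod z)\<^sup>2))\<^sup>2" for q z
  have [measurable]: "H q \<in> borel_measurable borel" for q unfolding H_def by measurable
  obtain q where q: "(\<integral>\<^sup>+ z. ennreal (H q z) \<partial>area)
     \<le> ennreal (1 / (d\<^sup>2 * R\<^sup>2)) * (\<integral>\<^sup>+ z\<in>ball 0 R. ennreal ((cmod (poly p z) * exp (- (cmod z)\<^sup>2))\<^sup>2) \<partial>area)"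
    using polynomial_cutoff[OF d(1) _ R(1) R', of p] d unfolding H_def by auto
  have "2 * d * R\<^sup>2 \<le> 1 * R\<^sup>2" using d by (intro mult_right_mono) auto
  then have areaA: "emeasure area A = ennreal (2 * d * R\<^sup>2)"
    unfolding A_def using d by (subst emeasure_area_annulus) (auto simp: algebra_simps)
  have "(\<integral>\<^sup>+ z\<in>ball 0 R. ennreal ((cmod (poly p z) * exp (- (cmod z)\<^sup>2))\<^sup>2) \<partial>area)
      \<le> (\<integral>\<^sup>+ z. 2 * (ennreal (Psi (poly p) z R) * indicator (ball 0 R) z) + 2 * indicator (ball 0 R) z \<partial>area)"
  proof (rule nn_integral_mono)
    fix z
    have "a\<^sup>2 \<le> 2 * (a - 1)\<^sup>2 + 2" for a :: real
      using zero_le_power2[of "a - 2"] by (simp add: power2_eq_square algebra_simps)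
    then have "ennreal ((cmod (poly p z) * exp (- (cmod z)\<^sup>2))\<^sup>2)
        \<le> ennreal (2 * (cmod (poly p z) * exp (- (cmod z)\<^sup>2) - 1)\<^sup>2 + 2)"
      by (rule ennreal_leI)
    also have "\<dots> = 2 * ennreal ((cmod (poly p z) * exp (- (cmod z)\<^sup>2) - 1)\<^sup>2) + 2"
      by (simp add: ennreal_plus ennreal_mult)
    finally show "ennreal ((cmod (poly p z) * exp (- (cmod z)\<^sup>2))\<^sup>2) * indicator (ball 0 R) z
        \<le> 2 * (ennreal (Psi (poly p) z R) * indicator (ball 0 R) z) + 2 * indicator (ball 0 R) z"
      by (simp add: indicator_def Psi_def)
  qed
  also have "\<dots> = 2 * J + 2 * ennreal (R\<^sup>2)"
    unfolding J_def using emeasure_area_ball[OF R(1)]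
    by (subst nn_integral_add) (simp_all add: nn_integral_cmult)
  also have "\<dots> = ennreal (2 * j + 2 * R\<^sup>2)"
    using j by (simp add: ennreal_mult)
  also have "\<dots> \<le> ennreal (4 * R\<^sup>2)"
    using j by (intro ennreal_leI) simp
  finally have "(\<integral>\<^sup>+ z. ennreal (H q z) \<partial>area) \<le> ennreal (1 / (d\<^sup>2 * R\<^sup>2)) * ennreal (4 * R\<^sup>2)"
    using q by (meson mult_left_mono order_trans zero_le)
  also have "\<dots> = ennreal (4 / d\<^sup>2)"
    using d R by (simp add: ennreal_mult[symmetric])
  finally have Hq: "(\<integral>\<^sup>+ z. ennreal (H q z) \<partial>area) \<le> ennreal (4 / d\<^sup>2)" .
  have "(\<integral>\<^sup>+ z. ennreal (Psi (poly q) z R) \<partial>area)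
      \<le> (\<integral>\<^sup>+ z. ennreal (1 + 1 / d) * ennreal (H q z)
        + ennreal (1 + d) * (ennreal (Psi (poly p) z R) * indicator (ball 0 R) z + indicator A z) \<partial>area)"
  proof (rule nn_integral_mono)
    fix z
    have "ennreal (Psi (poly q) z R) \<le> ennreal ((1 + 1 / d) * H q z
        + (1 + d) * (Psi (poly p) z R * indicator (ball 0 R) z + indicator A z))"
      unfolding H_def A_def by (intro ennreal_leI Psi_cutoff_le d R(1))
    also have "\<dots> = ennreal (1 + 1 / d) * ennreal (H q z)
        + ennreal (1 + d) * (ennreal (Psi (poly p) z R) * indicator (ball 0 R) z + indicator A z)"
      using d by (simp add: ennreal_plus ennreal_mult H_def ennreal_indicator)
    finally show "ennreal (Psi (poly q) z R) \<le> \<dots>" .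
  qed
  also have "\<dots> = ennreal (1 + 1 / d) * (\<integral>\<^sup>+ z. ennreal (H q z) \<partial>area) + ennreal (1 + d) * (J + ennreal (2 * d * R\<^sup>2))"
    unfolding J_def areaA[symmetric]
    by (subst nn_integral_add) (simp_all add: nn_integral_cmult nn_integral_add)
  also have "\<dots> \<le> ennreal (1 + 1 / d) * ennreal (4 / d\<^sup>2) + ennreal (1 + d) * (J + ennreal (2 * d * R\<^sup>2))"
    by (intro add_right_mono mult_left_mono Hq) auto
  also have "\<dots> = ennreal ((1 + 1 / d) * (4 / d\<^sup>2) + (1 + d) * (j + 2 * d * R\<^sup>2))"
    using d j by (simp add: ennreal_mult[symmetric] ennreal_plus[symmetric] del: ennreal_plus)
  also have "\<dots> \<le> ennreal (j + 13 * d * R\<^sup>2)"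
  \<comment> \<open>The 13 is 8 + 1 + 2 + 2: 8 from the correction error, 1 from d j \<le> d R^2, 2
    from the annulus, and 2 from d times its area, using d \<le> 1.\<close>
  proof (rule ennreal_leI)
    have "(1 + 1 / d) * (4 / d\<^sup>2) \<le> (2 / d) * (4 / d\<^sup>2)"
      using d by (intro mult_right_mono) (auto simp: field_simps)
    also have "\<dots> = 8 * d * (1 / d ^ 4)" using d by (simp add: eval_nat_numeral field_simps)
    also have "\<dots> \<le> 8 * d * R\<^sup>2" using d R by (intro mult_left_mono) auto
    finally have 1: "(1 + 1 / d) * (4 / d\<^sup>2) \<le> 8 * d * R\<^sup>2" .
    have 2: "d * j \<le> d * R\<^sup>2" using d j by (intro mult_left_mono) auto
    have "d * (2 * d * R\<^sup>2) \<le> 1 * (2 * d * R\<^sup>2)" using d by (intro mult_right_mono) auto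
    with 1 2 show "(1 + 1 / d) * (4 / d\<^sup>2) + (1 + d) * (j + 2 * d * R\<^sup>2) \<le> j + 13 * d * R\<^sup>2"
      by (simp only: distrib_right distrib_left mult_1 mult.assoc)
  qed
  also have "\<dots> = J + ennreal (13 * d * R\<^sup>2)"
    using d j by (simp add: ennreal_plus)
  finally show thesis unfolding J_def by (rule that)
qed

section \<open>Passing to infima and lower limits\<close>

lemma INF_add_const_ennreal:
  fixes f :: "'a \<Rightarrow> ennreal"
  assumes "A \<noteq> {}"
  shows "(INF x\<in>A. f x + c) = (INF x\<in>A. f x) + c"
  using continuous_at_Inf_mono[of "\<lambda>x. x + c" "f ` A"] assms
    continuous_add[of "at_right (Inf (f ` A))" "\<lambda>x. x" "\<lambda>x. c"]
  by (auto simp: mono_def image_comp)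

text \<open>Polynomials with discrepancy at most R^2 on the disc are truncated by
  \<open>tight_discrepancy_le\<close>, whose error 13dR^2 becomes 13d after division by R^2. All
  others do no better than the zero polynomial.\<close>

lemma tight_INF_le:
  assumes d: "0 < d" "2 * d \<le> 1" and R: "0 < R" "1 / d ^ 4 \<le> R\<^sup>2"
  shows "(INF f\<in>Pol. ennreal (1 / R\<^sup>2) * (\<integral>\<^sup>+ z. ennreal (Psi f z R) \<partial>area))
    \<le> (INF f\<in>Pol. ennreal (1 / R\<^sup>2) * (\<integral>\<^sup>+ z\<in>ball 0 R. ennreal (Psi f z R) \<partial>area)) + ennreal (13 * d)"
    (is "?L \<le> (INF f\<in>Pol. ?I f) + _")
proof -
  have scale: "ennreal (1 / R\<^sup>2) * ennreal (x * R\<^sup>2) = ennreal x" for x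
    using R by (simp add: ennreal_mult'[symmetric])
  have upper: "?L \<le> ennreal (1 / R\<^sup>2) * (\<integral>\<^sup>+ z. ennreal (Psi (poly q) z R) \<partial>area)" for q
    by (rule INF_lower) (simp add: Pol_def)
  have "?L \<le> ?I f + ennreal (13 * d)" if "f \<in> Pol" for f
  proof -
    obtain p where f: "f = poly p" using \<open>f \<in> Pol\<close> unfolding Pol_def by blast
    let ?J = "\<integral>\<^sup>+ z\<in>ball 0 R. ennreal (Psi (poly p) z R) \<partial>area"
    show ?thesis
    proof (cases "?J \<le> ennreal (R\<^sup>2)")
      case True
      obtain q where "(\<integral>\<^sup>+ z. ennreal (Psi (poly q) z R) \<partial>area) \<le> ?J + ennreal (13 * d * R\<^sup>2)"
        using tight_discrepancy_le[OF d R True] by blast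
      then have "ennreal (1 / R\<^sup>2) * (\<integral>\<^sup>+ z. ennreal (Psi (poly q) z R) \<partial>area)
          \<le> ennreal (1 / R\<^sup>2) * (?J + ennreal (13 * d * R\<^sup>2))"
        by (rule mult_left_mono) simp
      also have "\<dots> = ?I f + ennreal (13 * d)" by (simp add: f distrib_left scale)
      finally show ?thesis using upper order_trans by blast
    next
      case False
      \<comment> \<open>For the zero polynomial the integrand is the indicator of the disc, so its
        full discrepancy is exactly R^2, less than that of \<open>p\<close> on the disc
        alone.\<close>
      have "(\<integral>\<^sup>+ z. ennreal (Psi (poly 0) z R) \<partial>area) = (\<integral>\<^sup>+ z. indicator (ball 0 R) z \<partial>area)"
        by (intro nn_integral_cong) (auto simp: Psi_def indicator_def)
      also have "\<dots> = ennreal (R\<^sup>2)" by (simp add: emeasure_area_ball[OF R(1)])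
      also have "\<dots> \<le> ?J" using False by simp
      finally have "ennreal (1 / R\<^sup>2) * (\<integral>\<^sup>+ z. ennreal (Psi (poly 0) z R) \<partial>area) \<le> ?I f"
        unfolding f by (rule mult_left_mono) simp
      then have "?L \<le> ?I f" using upper order_trans by blast
      then show ?thesis by (rule order_trans) simp
    qed
  qed
  then have "?L \<le> (INF f\<in>Pol. ?I f + ennreal (13 * d))" by (rule INF_greatest)
  also have "\<dots> = (INF f\<in>Pol. ?I f) + ennreal (13 * d)" by (rule INF_add_const_ennreal) (auto simp: Pol_def)
  finally show ?thesis .
qed

theorem theorem1p4: "planar_discrepancy_density = tight_planar_discrepancy_density"
proof (rule antisym)
  \<comment> \<open>The easy direction: a nonnegative integrand is integrated over a smaller
    set.\<close>
  show "planar_discrepancy_density \<le> tight_planar_discrepancy_density"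
    unfolding planar_discrepancy_density_def tight_planar_discrepancy_density_def
    by (intro Liminf_mono always_eventually allI INF_mono' mult_left_mono nn_integral_mono)
      (auto simp: indicator_def)
  show "tight_planar_discrepancy_density \<le> planar_discrepancy_density"
  proof (rule ennreal_le_epsilon)
    fix e :: real assume e: "0 < e"
    \<comment> \<open>Chosen so that the loss 13d is at most \<open>e\<close>, while 2d \<le> 1
      keeps the inner radius of the annulus real.\<close>
    define d where "d = min (1 / 2) (e / 13)"
    have d: "0 < d" "2 * d \<le> 1" "13 * d \<le> e" using e by (auto simp: d_def)
    have "eventually (\<lambda>R. 0 < R \<and> 1 / d ^ 4 \<le> R\<^sup>2) at_top"
    proof (rule eventually_at_top_linorderI)
      fix R :: real assume R: "1 + 1 / d ^ 4 \<le> R"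
      have "0 < 1 / d ^ 4" using d by simp
      with R have "1 \<le> R" "1 / d ^ 4 \<le> R" by linarith+
      moreover have "R * 1 \<le> R * R" using \<open>1 \<le> R\<close> by (intro mult_left_mono) auto
      ultimately show "0 < R \<and> 1 / d ^ 4 \<le> R\<^sup>2" unfolding power2_eq_square by linarith
    qed
    then have "eventually (\<lambda>R. (INF f\<in>Pol. ennreal (1 / R\<^sup>2) * (\<integral>\<^sup>+ z. ennreal (Psi f z R) \<partial>area))
        \<le> (INF f\<in>Pol. ennreal (1 / R\<^sup>2) * (\<integral>\<^sup>+ z\<in>ball 0 R. ennreal (Psi f z R) \<partial>area)) + ennreal e) at_top"
    proof eventually_elim
      case (elim R)
      then show ?case
        using order_trans[OF tight_INF_le[OF d(1,2), of R] add_left_mono[OF ennreal_leI[OF d(3)]]] by simp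
    qed
    then have "tight_planar_discrepancy_density \<le> Liminf at_top (\<lambda>R::real.
        (INF f\<in>Pol. ennreal (1 / R\<^sup>2) * (\<integral>\<^sup>+ z\<in>ball 0 R. ennreal (Psi f z R) \<partial>area)) + ennreal e)"
      unfolding tight_planar_discrepancy_density_def by (rule Liminf_mono)
    also have "\<dots> = planar_discrepancy_density + ennreal e"
      unfolding planar_discrepancy_density_def by (rule Liminf_add_const) simp
    finally show "tight_planar_discrepancy_density \<le> planar_discrepancy_density + ennreal e" .
  qed
qed

end
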